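(* Let $m$ be a positive integer that is not a perfect square. Then there are infinitely many primes $r$ such that for every integer $n \ge 1$, the integer $m r^{2n}$ is an outlier for $A_r$, the quaternion algebra over $\mathbb{Q}$ ramified exactly at $r$ and $\infty$.
   Context: An element of $A_r$ is an integer if its monic minimal polynomial over $\mathbb{Q}$ has coefficients in $\mathbb{Z}$. A positive integer $m$ is an outlier for $A_r$ if it is not the reduced norm of any integer of $A_r$ (every positive integer is a reduced norm of some element of $A_r$). *)

theory Defs
  imports "HOL-Algebra.Algebraic_Closure_Type" Complex_Main
begin

text \<open>
  The quaternion algebra \<open>(a, b | K)\<close> with \<open>K\<close>-basis \<open>1, i, j, ij\<close> subject to
  \<open>i\<^sup>2 = a\<close>, \<open>j\<^sup>2 = b\<close>, \<open>ji = -ij\<close>. Every quaternion algebra over a field \<open>K\<close> of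
  characteristic different from 2 is of this form with \<open>a\<close>, \<open>b\<close> nonzero.
\<close>

datatype 'k quat = Quat (qre: 'k) (qi: 'k) (qj: 'k) (qk: 'k)

definition quat_mult :: "('k, 'm) ring_scheme \<Rightarrow> 'k \<Rightarrow> 'k \<Rightarrow> 'k quat \<Rightarrow> 'k quat \<Rightarrow> 'k quat" where
  "quat_mult K a b x y =
    Quat
      (qre x \<otimes>\<^bsub>K\<^esub> qre y \<oplus>\<^bsub>K\<^esub> a \<otimes>\<^bsub>K\<^esub> (qi x \<otimes>\<^bsub>K\<^esub> qi y) \<oplus>\<^bsub>K\<^esub> b \<otimes>\<^bsub>K\<^esub> (qj x \<otimes>\<^bsub>K\<^esub> qj y)
        \<ominus>\<^bsub>K\<^esub> a \<otimes>\<^bsub>K\<^esub> b \<otimes>\<^bsub>K\<^esub> (qk x \<otimes>\<^bsub>K\<^esub> qk y))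
      (qre x \<otimes>\<^bsub>K\<^esub> qi y \<oplus>\<^bsub>K\<^esub> qi x \<otimes>\<^bsub>K\<^esub> qre y
        \<oplus>\<^bsub>K\<^esub> b \<otimes>\<^bsub>K\<^esub> (qk x \<otimes>\<^bsub>K\<^esub> qj y \<ominus>\<^bsub>K\<^esub> qj x \<otimes>\<^bsub>K\<^esub> qk y))
      (qre x \<otimes>\<^bsub>K\<^esub> qj y \<oplus>\<^bsub>K\<^esub> qj x \<otimes>\<^bsub>K\<^esub> qre y
        \<oplus>\<^bsub>K\<^esub> a \<otimes>\<^bsub>K\<^esub> (qi x \<otimes>\<^bsub>K\<^esub> qk y \<ominus>\<^bsub>K\<^esub> qk x \<otimes>\<^bsub>K\<^esub> qi y))
      (qre x \<otimes>\<^bsub>K\<^esub> qk y \<oplus>\<^bsub>K\<^esub> qk x \<otimes>\<^bsub>K\<^esub> qre y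
        \<oplus>\<^bsub>K\<^esub> (qi x \<otimes>\<^bsub>K\<^esub> qj y \<ominus>\<^bsub>K\<^esub> qj x \<otimes>\<^bsub>K\<^esub> qi y))"

definition quat_alg :: "('k, 'm) ring_scheme \<Rightarrow> 'k \<Rightarrow> 'k \<Rightarrow> 'k quat ring" where
  "quat_alg K a b =
    \<lparr> carrier = {x. qre x \<in> carrier K \<and> qi x \<in> carrier K \<and> qj x \<in> carrier K \<and> qk x \<in> carrier K},
      monoid.mult = quat_mult K a b,
      one = Quat \<one>\<^bsub>K\<^esub> \<zero>\<^bsub>K\<^esub> \<zero>\<^bsub>K\<^esub> \<zero>\<^bsub>K\<^esub>,
      ring.zero = Quat \<zero>\<^bsub>K\<^esub> \<zero>\<^bsub>K\<^esub> \<zero>\<^bsub>K\<^esub> \<zero>\<^bsub>K\<^esub>,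
      add = (\<lambda>x y. Quat (qre x \<oplus>\<^bsub>K\<^esub> qre y) (qi x \<oplus>\<^bsub>K\<^esub> qi y)
                        (qj x \<oplus>\<^bsub>K\<^esub> qj y) (qk x \<oplus>\<^bsub>K\<^esub> qk y)) \<rparr>"

definition is_division_ring :: "('a, 'm) ring_scheme \<Rightarrow> bool" where
  "is_division_ring D \<longleftrightarrow> ring D \<and> Units D = carrier D - {\<zero>\<^bsub>D\<^esub>}"


text \<open>
  The field of \<open>p\<close>-adic numbers, as the completion of the rationals with respect to the
  \<open>p\<close>-adic absolute value: rational Cauchy sequences modulo null sequences.
\<close>

definition padic_val :: "nat \<Rightarrow> rat \<Rightarrow> int" where
  "padic_val p x = int (multiplicity (int p) (fst (quotient_of x)))
                 - int (multiplicity (int p) (snd (quotient_of x)))"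

definition padic_abs :: "nat \<Rightarrow> rat \<Rightarrow> real" where
  "padic_abs p x = (if x = 0 then 0 else real p powi (- padic_val p x))"

definition padic_cauchy :: "nat \<Rightarrow> (nat \<Rightarrow> rat) \<Rightarrow> bool" where
  "padic_cauchy p u \<longleftrightarrow> (\<forall>e>0. \<exists>N. \<forall>m\<ge>N. \<forall>n\<ge>N. padic_abs p (u m - u n) < e)"

definition padic_cauchy_ring :: "nat \<Rightarrow> (nat \<Rightarrow> rat) ring" where
  "padic_cauchy_ring p =
    \<lparr> carrier = {u. padic_cauchy p u},
      monoid.mult = (\<lambda>u w n. u n * w n),
      one = (\<lambda>_. 1),
      ring.zero = (\<lambda>_. 0),
      add = (\<lambda>u w n. u n + w n) \<rparr>"

definition padic_null :: "nat \<Rightarrow> (nat \<Rightarrow> rat) set" where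
  "padic_null p = {u. (\<lambda>n. padic_abs p (u n)) \<longlonglongrightarrow> 0}"

definition padic_field :: "nat \<Rightarrow> (nat \<Rightarrow> rat) set ring" where
  "padic_field p = padic_cauchy_ring p Quot padic_null p"

definition padic_of_rat :: "nat \<Rightarrow> rat \<Rightarrow> (nat \<Rightarrow> rat) set" where
  "padic_of_rat p x = padic_null p +>\<^bsub>padic_cauchy_ring p\<^esub> (\<lambda>_. x)"


text \<open>
  The scalar extension of \<open>(a, b | \<rat>)\<close> to a completion \<open>\<rat>\<^sub>v\<close> is \<open>(a, b | \<rat>\<^sub>v)\<close>; the algebra
  is ramified at \<open>v\<close> if this is a division ring.
\<close>

datatype place = Finite_Place nat | Infinite_Place

fun ramified_at :: "rat \<Rightarrow> rat \<Rightarrow> place \<Rightarrow> bool" where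
  "ramified_at a b (Finite_Place p) \<longleftrightarrow> Factorial_Ring.prime p \<and>
     is_division_ring (quat_alg (padic_field p) (padic_of_rat p a) (padic_of_rat p b))"
| "ramified_at a b Infinite_Place \<longleftrightarrow>
     is_division_ring (quat_alg (ring_of_type_algebra :: real ring) (of_rat a) (of_rat b))"


abbreviation rat_quat_alg :: "rat \<Rightarrow> rat \<Rightarrow> rat quat ring" where
  "rat_quat_alg a b \<equiv> quat_alg ring_of_type_algebra a b"

definition quat_of_rat :: "rat \<Rightarrow> rat quat" where
  "quat_of_rat c = Quat c 0 0 0"

definition quat_conj :: "rat quat \<Rightarrow> rat quat" where
  "quat_conj x = Quat (qre x) (- qi x) (- qj x) (- qk x)"

definition reduced_norm :: "rat \<Rightarrow> rat \<Rightarrow> rat quat \<Rightarrow> rat" where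
  "reduced_norm a b x = (qre x)\<^sup>2 - a * (qi x)\<^sup>2 - b * (qj x)\<^sup>2 + a * b * (qk x)\<^sup>2"

definition quat_poly_eval :: "rat \<Rightarrow> rat \<Rightarrow> rat poly \<Rightarrow> rat quat \<Rightarrow> rat quat" where
  "quat_poly_eval a b f x =
     (\<Oplus>\<^bsub>rat_quat_alg a b\<^esub> i \<in> {..Polynomial.degree f}.
        quat_of_rat (Polynomial.coeff f i) \<otimes>\<^bsub>rat_quat_alg a b\<^esub> (x [^]\<^bsub>rat_quat_alg a b\<^esub> i))"

definition is_minimal_poly :: "rat \<Rightarrow> rat \<Rightarrow> rat quat \<Rightarrow> rat poly \<Rightarrow> bool" where
  "is_minimal_poly a b x f \<longleftrightarrow>
     lead_coeff f = 1 \<and> quat_poly_eval a b f x = \<zero>\<^bsub>rat_quat_alg a b\<^esub> \<and>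
     (\<forall>g. g \<noteq> 0 \<longrightarrow> quat_poly_eval a b g x = \<zero>\<^bsub>rat_quat_alg a b\<^esub> \<longrightarrow>
        Polynomial.degree f \<le> Polynomial.degree g)"

definition quat_integer :: "rat \<Rightarrow> rat \<Rightarrow> rat quat \<Rightarrow> bool" where
  "quat_integer a b x \<longleftrightarrow>
     (\<exists>f. is_minimal_poly a b x f \<and> (\<forall>i. Polynomial.coeff f i \<in> \<int>))"

definition outlier :: "rat \<Rightarrow> rat \<Rightarrow> nat \<Rightarrow> bool" where
  "outlier a b m \<longleftrightarrow> m > 0 \<and>
     (\<nexists>x. x \<in> carrier (rat_quat_alg a b) \<and> quat_integer a b x \<and> reduced_norm a b x = of_nat m)"


lemma minus_ring_of_type_algebra:
  fixes x y :: "'a :: comm_ring_1"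
  shows "x \<ominus>\<^bsub>ring_of_type_algebra\<^esub> y = x - y"
proof -
  interpret R: cring "ring_of_type_algebra :: 'a ring" by (rule cring_from_type_algebra)
  have "\<ominus>\<^bsub>ring_of_type_algebra\<^esub> y = - y"
    by (rule R.minus_equality) (auto simp: ring_of_type_algebra_def)
  thus ?thesis by (simp add: R.minus_eq) (simp add: ring_of_type_algebra_def)
qed

lemma quat_mult_conj:
  "x \<otimes>\<^bsub>rat_quat_alg a b\<^esub> quat_conj x = quat_of_rat (reduced_norm a b x)"
  by (cases x)
     (simp add: quat_alg_def quat_mult_def minus_ring_of_type_algebra, 
      simp add: ring_of_type_algebra_def quat_conj_def quat_of_rat_def reduced_norm_def
        power2_eq_square algebra_simps)

end

theory Submission
  imports Defs "HOL-Number_Theory.Number_Theory"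
begin

text \<open>
  An integer \<open>x\<close> of \<open>A\<^sub>r\<close> of reduced norm \<open>m r\<^bsup>2n\<^esup>\<close> has integral trace \<open>t\<close>, and it is not
  rational because \<open>m\<close> is not a square. As \<open>A\<^sub>r\<close> is definite, \<open>t\<^sup>2 - 4 m r\<^bsup>2n\<^esup> < 0\<close>; as \<open>A\<^sub>r\<close> is
  ramified at \<open>r\<close>, this discriminant is not a square in \<open>\<rat>\<^sub>r\<close>. Write \<open>t = r\<^bsup>k\<^esup> t'\<close> with \<open>k\<close>
  maximal subject to \<open>k \<le> n\<close> and divide the discriminant by \<open>r\<^bsup>2k\<^esup>\<close>. If \<open>k < n\<close>, the quotient
  is congruent to the nonzero square \<open>t'\<^sup>2\<close> modulo \<open>r\<close>; if \<open>k = n\<close>, it is one of the finitely many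
  negative integers of the form \<open>t'\<^sup>2 - 4 m\<close>. So it suffices that \<open>r\<close> is an odd prime
  modulo which all nonzero integers up to \<open>4 m\<close> in absolute value are nonzero squares, for then
  Hensel's lemma gives a contradiction. By quadratic reciprocity all large primes
  \<open>r \<equiv> 1\<close> modulo \<open>8 (4 m)!\<close> have this property.
\<close>

section \<open>Primes modulo which all small integers are squares\<close>

text \<open>Euclid's argument. With \<open>c = f(0)\<close> nonzero and \<open>P\<close> the product
  of the supposedly finite set of primes, an argument divisible by \<open>c * P\<close> gives the
  value \<open>c * w\<close> with \<open>w\<close> congruent to 1 modulo \<open>P\<close>, so a
  prime factor of \<open>w\<close> is new.\<close>

lemma infinite_prime_divisors_poly:
  fixes f :: "int poly"
  assumes "Polynomial.degree f > 0"
  shows "infinite {p :: nat. Factorial_Ring.prime p \<and> (\<exists>a :: nat. int p dvd poly f (int a))}"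
    (is "infinite ?S")
proof
  assume fin: "finite ?S"
  define c where "c = poly f 0"
  have c0: "c \<noteq> 0"
  proof
    assume "c = 0"
    \<comment> \<open>If \<open>f(0) = 0\<close>, every prime divides the value at 0.\<close>
    hence "{p :: nat. Factorial_Ring.prime p} \<subseteq> ?S" by (auto simp: c_def intro!: exI[of _ 0])
    thus False using fin primes_infinite finite_subset by blast
  qed
  define P where "P = \<Prod>?S"
  have P0: "P \<noteq> 0" using fin by (auto simp: P_def)
  obtain f' where f': "f = pCons c f'" by (cases f) (auto simp: c_def)
  \<comment> \<open>The absolute value keeps the argument a natural number; the sign is restored by
    \<open>sgn c\<close> in \<open>w\<close>.\<close>
  define k :: "nat \<Rightarrow> nat" where "k y = nat \<bar>c\<bar> * P * y" for y
  have inj: "inj (\<lambda>y. int (k y))" using c0 P0 by (auto simp: inj_def k_def)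
  \<comment> \<open>\<open>f\<close> takes the values \<open>c\<close> and \<open>-c\<close> only
    finitely often, so some argument \<open>k y\<close> makes \<open>w\<close> differ from 1 and
    -1.\<close>
  have "f - [:c:] \<noteq> 0" "f + [:c:] \<noteq> 0" using assms
    by (auto simp: f' split: if_splits)
  hence "finite ({x. poly (f - [:c:]) x = 0} \<union> {x. poly (f + [:c:]) x = 0})"
    using poly_roots_finite by blast
  moreover have "infinite (range (\<lambda>y. int (k y)))" using inj by (simp add: finite_image_iff)
  ultimately obtain x where "x \<in> range (\<lambda>y. int (k y))"
      "x \<notin> {x. poly (f - [:c:]) x = 0} \<union> {x. poly (f + [:c:]) x = 0}"
    by (meson finite_subset subsetI)
  then obtain y where y: "poly f (int (k y)) \<noteq> c" "poly f (int (k y)) \<noteq> - c"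
    by (auto simp: add_eq_0_iff2)
  define w where "w = 1 + sgn c * int P * int y * poly f' (int (k y))"
  have ky: "int (k y) = c * (sgn c * int P * int y)"
    unfolding k_def using abs_sgn[of c] by (simp add: mult.assoc[symmetric] del: abs_sgn)
  have "poly f (int (k y)) = c + int (k y) * poly f' (int (k y))" by (simp add: f')
  hence w: "poly f (int (k y)) = c * w"
    by (subst (asm) (2) ky) (simp add: w_def algebra_simps)
  have "nat \<bar>w\<bar> \<noteq> 1" using y w by (auto simp: nat_eq_iff abs_if split: if_splits)
  then obtain q where q: "Factorial_Ring.prime q" "q dvd nat \<bar>w\<bar>" using prime_factor_nat by blast
  hence qw: "int q dvd w" by (metis dvd_abs_iff int_dvd_int_iff int_nat_eq abs_ge_zero)
  hence "q \<in> ?S" using q w by (auto intro!: exI[of _ "k y"])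
  hence "int q dvd int P" using fin by (auto simp: P_def intro: dvd_prodI)
  hence "int q dvd w - 1" by (simp add: w_def)
  hence "int q dvd 1" using qw by (metis dvd_diff_right_iff)
  thus False using q by simp
qed

section \<open>Primes modulo which some element has a prescribed order\<close>

lemma map_poly_of_rat_mult:
  "map_poly (of_rat :: rat \<Rightarrow> complex) (p * q) = map_poly of_rat p * map_poly of_rat q"
  by (intro poly_eqI) (simp add: coeff_map_poly coeff_mult of_rat_sum of_rat_mult)

lemma map_poly_of_rat_add:
  "map_poly (of_rat :: rat \<Rightarrow> complex) (p + q) = map_poly of_rat p + map_poly of_rat q"
  by (intro poly_eqI) (simp add: coeff_map_poly of_rat_add)

text \<open>Clearing denominators makes divisibility of values by primes meaningful. Polynomial
  identities over the rationals are transported through values; the coefficientwise relation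
  preserves the degree.\<close>

lemma rat_poly_common_denominator:
  fixes q :: "rat poly"
  obtains c :: int and Q :: "int poly"
  where "c > 0" "\<And>a. of_int c * poly q (of_int a) = of_int (poly Q a)"
    "map_poly of_int Q = smult (of_int c) q"
proof -
  have "\<exists>c Q. c > 0 \<and> (\<forall>a. of_int c * poly q (of_int a) = of_int (poly Q a))
          \<and> map_poly of_int Q = smult (of_int c) q"
  proof (induction q)
    case 0
    show ?case by (intro exI[of _ 1] exI[of _ 0]) auto
  next
    case (pCons x q)
    then obtain c Q where cQ: "c > 0" "\<And>a. of_int c * poly q (of_int a) = of_int (poly Q a)"
      "map_poly of_int Q = smult (of_int c) q" by blast
    obtain n d where nd: "quotient_of x = (n, d)" by force
    have d: "d > 0" "x = of_int n / of_int d"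
      using nd quotient_of_denom_pos quotient_of_div by blast+
    have "of_int (c * d) * poly (pCons x q) (of_int a) = of_int (poly (pCons (c * n) (smult d Q)) a)" for a
    proof -
      have "of_int (c * d) * poly (pCons x q) (of_int a)
         = of_int c * (of_int d * x) + of_int d * of_int a * (of_int c * poly q (of_int a))"
        by (simp add: algebra_simps)
      also have "of_int d * x = of_int n" using d by simp
      finally show ?thesis by (simp add: cQ algebra_simps)
    qed
    moreover have "map_poly of_int (pCons (c * n) (smult d Q)) = smult (of_int (c * d)) (pCons x q)"
      using d cQ(3) by (simp add: map_poly_pCons map_poly_smult smult_smult mult.commute)
    ultimately show ?case using cQ(1) d(1)
      by (intro exI[of _ "c * d"] exI[of _ "pCons (c * n) (smult d Q)"]) simp
  qed
  thus thesis using that by blast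
qed

text \<open>A large prime dividing a value \<open>g(a)\<close> of the minimal polynomial \<open>g\<close> of a primitive
  \<open>N\<close>-th root of unity divides \<open>a ^ N - 1\<close> but, as \<open>g\<close> is coprime to \<open>X ^ d - 1\<close>, none of
  the \<open>a ^ d - 1\<close> with \<open>0 < d < N\<close>.\<close>

lemma infinite_primes_with_element_of_order:
  fixes N :: nat
  assumes "N > 0"
  shows "infinite {p :: nat. Factorial_Ring.prime p \<and> (\<exists>a :: nat. ord p a = N)}"
proof -
  \<comment> \<open>\<open>z\<close> is a primitive \<open>N\<close>-th root of unity, and
    \<open>ev\<close> evaluates rational polynomials there.\<close>
  define z where "z = cis (2 * pi / N)"
  define ev where "ev f = poly (map_poly of_rat f) z" for f :: "rat poly"
  have ev_mult: "ev (p * q) = ev p * ev q" for p q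
    by (simp add: ev_def map_poly_of_rat_mult)
  have ev_add: "ev (p + q) = ev p + ev q" for p q
    by (simp add: ev_def map_poly_of_rat_add)
  define h where "h d = (Polynomial.monom 1 d + [:-1:] :: rat poly)" for d :: nat
  have poly_h: "poly (h d) x = x ^ d - 1" for d and x :: rat
    by (simp add: h_def poly_monom)
  have ev_h: "ev (h d) = z ^ d - 1" for d
    unfolding h_def ev_add
    by (simp add: ev_def map_poly_monom poly_monom map_poly_pCons)
  have zN: "z ^ N = 1" using assms by (simp add: z_def Complex.DeMoivre)
  have zd: "z ^ d \<noteq> 1" if "0 < d" "d < N" for d
  proof
    assume "z ^ d = 1"
    hence "cis (real d * (2 * pi / N)) = 1" by (simp add: z_def Complex.DeMoivre)
    hence "cos (2 * pi * d / N) = 1" by (simp add: complex_eq_iff mult_ac)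
    then obtain n :: int where n: "2 * pi * d / N = of_int n * 2 * pi"
      unfolding cos_one_2pi_int by auto
    hence "real d = of_int n * real N" using assms by (simp add: field_simps)
    hence "int d = n * int N"
      by (metis of_int_eq_iff of_int_mult of_int_of_nat_eq)
    hence "N dvd d" by (metis dvd_triv_right int_dvd_int_iff)
    thus False using that by (auto dest: dvd_imp_le)
  qed
  \<comment> \<open>A nonzero polynomial of least degree vanishing at \<open>z\<close> is the
    minimal polynomial of \<open>z\<close> up to a scalar factor.\<close>
  define A where "A = {f. f \<noteq> 0 \<and> ev f = 0}"
  have hN: "h N \<in> A"
  proof -
    have "poly (h N) 0 = -1" using assms by (simp add: poly_h)
    hence "h N \<noteq> 0" by auto
    thus ?thesis using zN by (simp add: A_def ev_h)
  qed
  define g where "g = arg_min Polynomial.degree (\<lambda>f. f \<in> A)"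
  have g: "g \<in> A" and g_min: "\<And>f. f \<in> A \<Longrightarrow> Polynomial.degree g \<le> Polynomial.degree f"
    using arg_min_nat_lemma[of "\<lambda>f. f \<in> A" "h N" Polynomial.degree] hN by (auto simp: g_def)
  have g0: "g \<noteq> 0" "ev g = 0" using g by (auto simp: A_def)
  have deg_g: "Polynomial.degree g > 0"
  proof (rule ccontr)
    assume "\<not> ?thesis"
    then obtain x where "g = [:x:]" by (metis degree_eq_zeroE gr0I)
    thus False using g0 by (auto simp: ev_def map_poly_pCons)
  qed
  have g_dvd: "g dvd h N"
  proof -
    \<comment> \<open>The remainder modulo \<open>g\<close> also vanishes at \<open>z\<close>; being
      of smaller degree than \<open>g\<close>, it is zero.\<close>
    have "ev (h N) = ev (h N div g * g) + ev (h N mod g)"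
      by (metis ev_add div_mult_mod_eq)
    hence "ev (h N mod g) = 0" using hN g0 by (simp add: ev_mult A_def)
    hence "h N mod g = 0"
      using g_min[of "h N mod g"] degree_mod_less[of g "h N"] g0 deg_g
      by (fastforce simp: A_def)
    thus ?thesis by auto
  qed
  then obtain w where w: "h N = g * w" by (auto elim: dvdE)
  have bez: "\<exists>u v. u * g + v * h d = 1" if d: "0 < d" "d < N" for d
  proof -
    \<comment> \<open>The common divisor \<open>e\<close> does not vanish at \<open>z\<close>,
      because \<open>h d\<close> does not; hence its cofactor \<open>k\<close> in \<open>g\<close>
      does, and minimality of \<open>g\<close> makes \<open>e\<close> constant.\<close>
    define e where "e = gcd g (h d)"
    obtain k l where k: "g = e * k" and l: "h d = e * l" unfolding e_def by (metis dvdE gcd_dvd1 gcd_dvd2)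
    have "ev e \<noteq> 0" using l zd[OF d] ev_h[of d] by (auto simp: ev_mult)
    hence "ev k = 0" using g0 k by (simp add: ev_mult)
    hence "k \<in> A" using k g0 by (auto simp: A_def)
    hence "Polynomial.degree e = 0" using g_min[of k] k g0 degree_mult_eq[of e k] by auto
    moreover have "e \<noteq> 0" using k g0 by auto
    ultimately have "is_unit e" by (simp add: is_unit_iff_degree)
    hence "gcd g (h d) = 1" unfolding e_def by (simp add: is_unit_gcd coprime_iff_gcd_eq_1)
    thus ?thesis by (metis bezout_coefficients_fst_snd)
  qed
  obtain cg G where G: "cg > 0" "\<And>a. of_int cg * poly g (of_int a) = of_int (poly G a)"
    "map_poly of_int G = smult (of_int cg) g" using rat_poly_common_denominator by metis
  have "Polynomial.degree G > 0"
  proof -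
    have "G \<noteq> 0" using G(1,3) g0 by auto
    hence "Polynomial.degree G = Polynomial.degree (map_poly (of_int :: int \<Rightarrow> rat) G)"
      by (intro map_poly_degree_eq[symmetric]) auto
    thus ?thesis using G deg_g by simp
  qed
  from infinite_prime_divisors_poly[OF this]
  have inf: "infinite {p :: nat. Factorial_Ring.prime p \<and> (\<exists>a :: nat. int p dvd poly G (int a))}" .
  obtain cw W where W: "cw > 0" "\<And>a. of_int cw * poly w (of_int a) = of_int (poly W a)"
    using rat_poly_common_denominator by metis
  \<comment> \<open>Clearing denominators in \<open>h N = g * w\<close> multiplies
    \<open>a ^ N - 1\<close> by \<open>cw * cg\<close>, which a larger prime cannot divide.\<close>
  have dvd_N: "int p dvd a ^ N - 1" if "Factorial_Ring.prime p" "int p > cw * cg" "int p dvd poly G a" for p a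
  proof -
    have "of_int (cw * cg * (a ^ N - 1)) = (of_int (poly G a * poly W a) :: rat)"
      unfolding of_int_mult G(2)[symmetric] W(2)[symmetric]
      using arg_cong[OF w, of "\<lambda>f. poly f (of_int a)"] by (simp add: poly_h)
    hence "cw * cg * (a ^ N - 1) = poly G a * poly W a" by (simp only: of_int_eq_iff)
    hence "int p dvd (cw * cg) * (a ^ N - 1)" using that(3) by simp
    moreover have "\<not> int p dvd cw * cg" using that(2) W(1) G(1) by (auto dest: zdvd_imp_le)
    ultimately show ?thesis using that(1) by (simp add: prime_dvd_mult_iff)
  qed
  \<comment> \<open>Clearing denominators in the Bezout identity gives a positive integer depending
    only on \<open>d\<close>; every common divisor of \<open>poly G a\<close> and
    \<open>a ^ d - 1\<close> divides it. The value 1 is a filler for the other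
    \<open>d\<close>.\<close>
  have "\<forall>d. \<exists>E. E > 0 \<and> (0 < d \<and> d < N \<longrightarrow>
          (\<forall>p a. int p dvd poly G a \<longrightarrow> int p dvd a ^ d - 1 \<longrightarrow> int p dvd E))"
  proof
    fix d
    show "\<exists>E. E > 0 \<and> (0 < d \<and> d < N \<longrightarrow>
          (\<forall>p a. int p dvd poly G a \<longrightarrow> int p dvd a ^ d - 1 \<longrightarrow> int p dvd E))"
    proof (cases "0 < d \<and> d < N")
      case True
      then obtain u v where uv: "u * g + v * h d = 1" using bez by blast
      obtain cu U where U: "cu > 0" "\<And>a. of_int cu * poly u (of_int a) = of_int (poly U a)"
        using rat_poly_common_denominator by metis
      obtain cv V where V: "cv > 0" "\<And>a. of_int cv * poly v (of_int a) = of_int (poly V a)"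
        using rat_poly_common_denominator by metis
      have "cu * cv * cg = cv * poly U a * poly G a + cu * cg * poly V a * (a ^ d - 1)" for a
      proof -
        have "(of_int (cv * poly U a * poly G a + cu * cg * poly V a * (a ^ d - 1)) :: rat)
            = of_int (cu * cv * cg) * poly (u * g + v * h d) (of_int a)"
          unfolding of_int_mult of_int_add G(2)[symmetric] U(2)[symmetric] V(2)[symmetric]
          by (simp add: poly_h algebra_simps)
        also have "\<dots> = of_int (cu * cv * cg)" by (simp add: uv)
        finally show ?thesis by (simp only: of_int_eq_iff)
      qed
      hence "int p dvd cu * cv * cg" if "int p dvd poly G a" "int p dvd a ^ d - 1" for p a
        using that by (metis dvd_add dvd_mult)
      thus ?thesis using U(1) V(1) G(1) by (intro exI[of _ "cu * cv * cg"]) auto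
    qed (auto intro: exI[of _ 1])
  qed
  then obtain E where E: "\<And>d. E d > 0"
    "\<And>d p a. 0 < d \<Longrightarrow> d < N \<Longrightarrow> int p dvd poly G a \<Longrightarrow> int p dvd a ^ d - 1 \<Longrightarrow> int p dvd E d"
    by metis
  \<comment> \<open>No prime beyond \<open>B\<close> divides \<open>cw * cg\<close> or an
    \<open>E d\<close> with \<open>d < N\<close>, so only finitely many primes are lost.\<close>
  define B where "B = Max (insert (cw * cg) (E ` {..<N}))"
  have B: "cw * cg \<le> B" "\<And>d. d < N \<Longrightarrow> E d \<le> B" by (auto simp: B_def)
  have "{p :: nat. Factorial_Ring.prime p \<and> (\<exists>a :: nat. int p dvd poly G (int a))} - {..nat B}
      \<subseteq> {p. Factorial_Ring.prime p \<and> (\<exists>a. ord p a = N)}"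
  proof
    fix p assume "p \<in> {p :: nat. Factorial_Ring.prime p \<and> (\<exists>a :: nat. int p dvd poly G (int a))} - {..nat B}"
    then obtain a where p: "Factorial_Ring.prime p" "int p dvd poly G (int a)" "p \<notin> {..nat B}" by blast
    have pB: "int p > B" using p(3) by auto
    have cong_iff: "[a ^ d = 1] (mod p) \<longleftrightarrow> int p dvd int a ^ d - 1" for d
      by (metis cong_iff_dvd_diff cong_int_iff of_nat_1 of_nat_power)
    have "[a ^ N = 1] (mod p)" using dvd_N[OF p(1) _ p(2)] pB B(1) cong_iff by simp
    hence "ord p a dvd N" using ord_divides by blast
    hence le: "0 < ord p a" "ord p a \<le> N" using assms dvd_imp_le dvd_pos_nat by blast+
    have "\<not> ord p a < N"
    proof
      assume lt: "ord p a < N"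
      have "int p dvd int a ^ ord p a - 1" using ord[of a p] cong_iff by simp
      hence "int p dvd E (ord p a)" using E(2) le lt p(2) by blast
      hence "int p \<le> E (ord p a)" using E(1) by (simp add: zdvd_imp_le)
      thus False using B(2)[OF lt] pB by simp
    qed
    hence "ord p a = N" using le by simp
    thus "p \<in> {p. Factorial_Ring.prime p \<and> (\<exists>a. ord p a = N)}" using p(1) by blast
  qed
  thus ?thesis using inf by (meson Diff_infinite_finite finite_atMost infinite_super)
qed

section \<open>Quadratic residues\<close>

lemma QuadRes_mult: "QuadRes p a \<Longrightarrow> QuadRes p b \<Longrightarrow> QuadRes p (a * b)"
  unfolding QuadRes_def by (metis cong_mult power_mult_distrib)

text \<open>The power \<open>c = a ^ (N div 8)\<close> has order 8, so \<open>c ^ 4 = -1\<close>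
  modulo \<open>p\<close> and \<open>c\<^sup>2\<close> is a square root of -1. The inverse of
  \<open>c\<close> is \<open>- c ^ 3\<close>, and the sum of \<open>c\<close> and its inverse
  squares to 2.\<close>

lemma QuadRes_minus_one_two:
  fixes p :: nat
  assumes "Factorial_Ring.prime p" "8 dvd N" "ord p a = N" "N > 0"
  shows "QuadRes p (-1)" "QuadRes p 2"
proof -
  obtain k where k: "N = 8 * k" using assms by auto
  define c where "c = int a ^ k"
  have cong_iff: "[a ^ d = 1] (mod p) \<longleftrightarrow> int p dvd int a ^ d - 1" for d
    by (metis cong_iff_dvd_diff cong_int_iff of_nat_1 of_nat_power)
  have "int p dvd c ^ 8 - 1"
    using ord[of a p] assms(3) k cong_iff[of N] by (simp add: c_def power_mult mult.commute)
  moreover have "c ^ 8 - 1 = (c ^ 4 - 1) * (c ^ 4 + 1)"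
    by (simp add: algebra_simps flip: power_add)
  moreover have "\<not> int p dvd c ^ 4 - 1"
    using ord_minimal[of "4 * k" p a] assms k cong_iff[of "4 * k"] 
    by (simp add: c_def power_mult mult.commute)
  ultimately have c4: "int p dvd c ^ 4 + 1" using assms(1) by (simp add: prime_dvd_mult_iff)
  have "(c\<^sup>2)\<^sup>2 - (-1) = c ^ 4 + 1" by (simp flip: power_mult)
  thus "QuadRes p (-1)" using c4 by (metis QuadRes_def cong_iff_dvd_diff)
  have "(c - c ^ 3)\<^sup>2 - 2 = (c ^ 4 + 1) * (c\<^sup>2 - 2)"
    by (simp add: power2_eq_square power3_eq_cube power4_eq_xxxx algebra_simps)
  thus "QuadRes p 2" using c4 unfolding QuadRes_def cong_iff_dvd_diff by (metis dvd_mult2)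
qed

text \<open>The congruence modulo \<open>q\<close> makes \<open>p\<close> a square modulo
  \<open>q\<close>, and the one modulo 4 makes the sign in quadratic reciprocity positive.\<close>

lemma QuadRes_odd_prime:
  fixes p q :: nat
  assumes "Factorial_Ring.prime p" "Factorial_Ring.prime q" "2 < q" "p \<noteq> q" "[p = 1] (mod 4)" "[p = 1] (mod q)"
  shows "QuadRes p q"
proof -
  have p2: "2 < p"
  proof -
    have "p \<noteq> 2" using assms(5) by (auto simp: cong_def)
    thus ?thesis using prime_ge_2_nat[OF assms(1)] by simp
  qed
  have q1: "int p mod int q = 1" using assms(3,6) by (simp add: cong_def flip: of_nat_mod)
  have "Legendre p q = 1"
  proof -
    have "QuadRes q p" unfolding QuadRes_def by (rule exI[of _ 1]) (use q1 assms(3) in \<open>simp add: cong_def\<close>)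
    moreover have "\<not> [int p = 0] (mod int q)" using q1 by (simp add: cong_def)
    ultimately show ?thesis by (simp add: Legendre_def)
  qed
  moreover have "even ((p - 1) div 2)"
  proof -
    have "p mod 4 = 1" using assms(5) by (simp add: cong_def)
    thus ?thesis by presburger
  qed
  ultimately have "Legendre q p = 1"
    using Quadratic_Reciprocity[OF assms(1) p2 assms(2,3,4)] by simp
  thus ?thesis by (auto simp: Legendre_def split: if_splits)
qed

lemma QuadRes_if_all_prime_divisors:
  fixes p n :: nat
  assumes "n > 0" "\<And>q. Factorial_Ring.prime q \<Longrightarrow> q dvd n \<Longrightarrow> QuadRes p q"
  shows "QuadRes p n"
  using assms
proof (induction n rule: prime_divisors_induct)
  case (factor q n)
  hence "QuadRes p (int q * int n)" by (intro QuadRes_mult) auto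
  thus ?case by simp
qed (auto simp: QuadRes_def intro: exI[of _ 1])

text \<open>By multiplicativity of squares, only the sign, the prime 2 and the odd primes up to
  \<open>M\<close> have to be treated.\<close>

lemma infinite_primes_all_small_QuadRes:
  fixes M :: nat
  shows "infinite {p :: nat. Factorial_Ring.prime p \<and> 2 < p \<and>
    (\<forall>D :: int. D \<noteq> 0 \<longrightarrow> \<bar>D\<bar> \<le> int M \<longrightarrow> \<not> int p dvd D \<and> QuadRes p D)}"
proof -
  \<comment> \<open>An element of order \<open>N\<close> makes \<open>N\<close> divide
    \<open>p - 1\<close>. The factor 8 supplies square roots of -1 and 2; the factorial makes
    \<open>p\<close> congruent to 1 modulo every odd prime up to \<open>M\<close>, as reciprocity
    requires.\<close>
  define N :: nat where "N = 8 * fact M"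
  have N: "N > 0" "8 dvd N" by (auto simp: N_def)
  \<comment> \<open>Discarding \<open>p\<close> up to \<open>M + 2\<close> ensures that
    \<open>p\<close> is odd, divides no such \<open>D\<close> and differs from all prime divisors of
    \<open>D\<close>.\<close>
  have "{p :: nat. Factorial_Ring.prime p \<and> (\<exists>a :: nat. ord p a = N)} - {..M + 2} \<subseteq>
     {p :: nat. Factorial_Ring.prime p \<and> 2 < p \<and>
    (\<forall>D :: int. D \<noteq> 0 \<longrightarrow> \<bar>D\<bar> \<le> int M \<longrightarrow> \<not> int p dvd D \<and> QuadRes p D)}"
  proof (intro subsetI CollectI conjI allI impI)
    fix p assume "p \<in> {p :: nat. Factorial_Ring.prime p \<and> (\<exists>a :: nat. ord p a = N)} - {..M + 2}"
    then obtain a where p: "Factorial_Ring.prime p" "ord p a = N" "p > M + 2" by auto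
    show "Factorial_Ring.prime p" "2 < p" using p by auto
    have "coprime p a" using p(2) N by (metis ord_eq_0 less_numeral_extra(3))
    hence "N dvd totient p" using order_divides_totient p(2) by metis
    hence "N dvd p - 1" using p(1) by (simp add: totient_prime)
    hence cong: "[p = 1] (mod k)" if "k dvd N" for k
      using that prime_ge_1_nat[OF p(1)] dvd_trans
      by (metis cong_altdef_nat cong_sym_eq)
    have c4: "[p = 1] (mod 4)" by (rule cong, rule dvd_trans[OF _ N(2)]) simp
    fix D :: int assume D: "D \<noteq> 0" "\<bar>D\<bar> \<le> int M"
    show "\<not> int p dvd D" using D p(3) by (auto dest: dvd_imp_le_int)
    have "QuadRes p (nat \<bar>D\<bar>)"
    proof (rule QuadRes_if_all_prime_divisors)
      fix q assume q: "Factorial_Ring.prime q" "q dvd nat \<bar>D\<bar>"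
      hence qM: "q \<le> M" using D dvd_imp_le[OF q(2)] by auto
      show "QuadRes p q"
      proof (cases "q = 2")
        case True thus ?thesis using QuadRes_minus_one_two(2)[OF p(1) N(2) p(2) N(1)] by simp
      next
        case False
        hence "2 < q" using prime_ge_2_nat[OF q(1)] by simp
        moreover have "q dvd N" using qM \<open>2 < q\<close> by (auto simp: N_def intro!: dvd_mult dvd_fact)
        ultimately show ?thesis using QuadRes_odd_prime[OF p(1) q(1) _ _ c4] cong qM p(3) by simp
      qed
    qed (use D in auto)
    moreover have "D = int (nat \<bar>D\<bar>) \<or> D = - 1 * int (nat \<bar>D\<bar>)" by auto
    ultimately show "QuadRes p D"
      using QuadRes_mult QuadRes_minus_one_two(1)[OF p(1) N(2) p(2) N(1)] by metis
  qed
  thus ?thesis using infinite_primes_with_element_of_order[OF N(1)]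
    by (meson Diff_infinite_finite finite_atMost infinite_super)
qed

section \<open>The field of \<open>p\<close>-adic numbers\<close>

text \<open>The definition of \<open>padic_val\<close> uses lowest terms; cross-multiplication and
  additivity of the multiplicity show that any fraction gives the same result.\<close>

lemma padic_val_fract:
  assumes p: "Factorial_Ring.prime p" and "n \<noteq> 0" "d \<noteq> 0"
  shows "padic_val p (of_int n / of_int d) = int (multiplicity (int p) n) - int (multiplicity (int p) d)"
proof -
  obtain n' d' where nd: "quotient_of (of_int n / of_int d) = (n', d')" by force
  have d': "d' > 0" "(of_int n / of_int d :: rat) = of_int n' / of_int d'"
    using nd quotient_of_denom_pos quotient_of_div by blast+
  have "(of_int (n * d') :: rat) = of_int (n' * d)" using d' assms by (simp add: field_simps)
  hence eq: "n * d' = n' * d" by (simp only: of_int_eq_iff)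
  hence "n' \<noteq> 0" using assms d' by auto
  hence "multiplicity (int p) n + multiplicity (int p) d' = multiplicity (int p) n' + multiplicity (int p) d"
    using arg_cong[OF eq, of "multiplicity (int p)"] p assms d'
    by (simp add: prime_elem_multiplicity_mult_distrib)
  thus ?thesis by (simp add: padic_val_def nd)
qed

lemma padic_abs_nonneg [simp]: "0 \<le> padic_abs p x"
  by (simp add: padic_abs_def)

lemma padic_abs_0 [simp]: "padic_abs p 0 = 0"
  by (simp add: padic_abs_def)

lemma padic_abs_pos: "Factorial_Ring.prime p \<Longrightarrow> x \<noteq> 0 \<Longrightarrow> 0 < padic_abs p x"
  by (auto simp: padic_abs_def prime_gt_0_nat)

lemma padic_abs_mult:
  assumes p: "Factorial_Ring.prime p"
  shows "padic_abs p (x * y) = padic_abs p x * padic_abs p y"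
proof (cases "x = 0 \<or> y = 0")
  case False
  obtain n d where x: "x = of_int n / of_int d" "d > 0" by (metis quotient_of_div quotient_of_denom_pos surj_pair)
  obtain n' d' where y: "y = of_int n' / of_int d'" "d' > 0" by (metis quotient_of_div quotient_of_denom_pos surj_pair)
  have n: "n \<noteq> 0" "n' \<noteq> 0" using False x y by auto
  have "x * y = of_int (n * n') / of_int (d * d')" by (simp add: x y)
  hence "padic_val p (x * y) = padic_val p x + padic_val p y"
    using padic_val_fract[OF p, of "n * n'" "d * d'"] padic_val_fract[OF p, of n d]
      padic_val_fract[OF p, of n' d'] n x y p
    by (simp add: prime_elem_multiplicity_mult_distrib)
  hence "- padic_val p (x * y) = - padic_val p x + - padic_val p y" by simp
  hence "real p powi (- padic_val p (x * y)) = real p powi (- padic_val p x) * real p powi (- padic_val p y)"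
    using power_int_add[OF disjI1, of "real p" "- padic_val p x" "- padic_val p y"] prime_gt_0_nat[OF p] by simp
  thus ?thesis using False by (simp add: padic_abs_def)
qed auto

lemma padic_abs_minus [simp]: "padic_abs p (- x) = padic_abs p x"
  by (simp add: padic_abs_def padic_val_def rat_uminus_code Let_def split: prod.split)

lemma padic_abs_diff_commute: "padic_abs p (x - y) = padic_abs p (y - x)"
  using padic_abs_minus[of p "x - y"] by simp

lemma padic_abs_ultrametric:
  assumes p: "Factorial_Ring.prime p"
  shows "padic_abs p (x + y) \<le> max (padic_abs p x) (padic_abs p y)"
proof (cases "x = 0 \<or> y = 0 \<or> x + y = 0")
  case False
  obtain n d where x: "x = of_int n / of_int d" "d > 0" by (metis quotient_of_div quotient_of_denom_pos surj_pair)
  obtain n' d' where y: "y = of_int n' / of_int d'" "d' > 0" by (metis quotient_of_div quotient_of_denom_pos surj_pair)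
  \<comment> \<open>Over a common denominator only the integer numerators have to be
    compared.\<close>
  define A B E where "A = n * d'" and "B = n' * d" and "E = d * d'"
  have xy: "x = of_int A / of_int E" "y = of_int B / of_int E" "x + y = of_int (A + B) / of_int E"
    using x y by (simp_all add: A_def B_def E_def field_simps)
  have E: "E \<noteq> 0" using x y by (simp add: E_def)
  have nz: "A \<noteq> 0" "B \<noteq> 0" "A + B \<noteq> 0" using False xy by auto
  define k where "k = min (multiplicity (int p) A) (multiplicity (int p) B)"
  have "int p ^ k dvd A + B"
    by (intro dvd_add multiplicity_dvd') (simp_all add: k_def)
  hence "k \<le> multiplicity (int p) (A + B)" using nz p
    by (intro multiplicity_geI) auto
  hence "padic_val p (x + y) \<ge> min (padic_val p x) (padic_val p y)"
    using padic_val_fract[OF p nz(1) E] padic_val_fract[OF p nz(2) E] padic_val_fract[OF p nz(3) E] xy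
    by (auto simp: k_def min_def split: if_splits)
  hence "- padic_val p (x + y) \<le> - padic_val p x \<or> - padic_val p (x + y) \<le> - padic_val p y" by linarith
  thus ?thesis using False prime_ge_1_nat[OF p]
    by (auto simp: padic_abs_def le_max_iff_disj intro: power_int_increasing)
qed (auto simp: add_eq_0_iff)

lemma padic_abs_triangle:
  assumes "Factorial_Ring.prime p"
  shows "padic_abs p (x + y) \<le> padic_abs p x + padic_abs p y"
  using padic_abs_ultrametric[OF assms, of x y] padic_abs_nonneg[of p x] padic_abs_nonneg[of p y]
  by linarith

lemma padic_abs_of_int_le:
  assumes p: "Factorial_Ring.prime p" and "int p ^ k dvd z"
  shows "padic_abs p (of_int z) \<le> (1 / real p) ^ k"
proof (cases "z = 0")
  case False
  have "k \<le> multiplicity (int p) z" using assms False by (intro multiplicity_geI) auto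
  moreover have "padic_val p (of_int z) = int (multiplicity (int p) z)"
    using padic_val_fract[OF p False, of 1] by simp
  ultimately have "padic_abs p (of_int z) \<le> real p powi (- int k)"
    using False prime_ge_1_nat[OF p] by (auto simp: padic_abs_def intro!: power_int_increasing)
  thus ?thesis by (simp add: power_int_minus power_one_over inverse_eq_divide)
qed auto

section \<open>Cauchy sequences and null sequences\<close>

lemma padic_cauchy_bounded:
  assumes p: "Factorial_Ring.prime p" and u: "padic_cauchy p u"
  obtains B where "B > 0" "\<And>n. padic_abs p (u n) \<le> B"
proof -
  obtain N where N: "\<And>m n. m \<ge> N \<Longrightarrow> n \<ge> N \<Longrightarrow> padic_abs p (u m - u n) < 1"
    using u unfolding padic_cauchy_def by (meson zero_less_one)
  \<comment> \<open>The sum covers the indices up to \<open>N\<close>, and the extra 1 covers the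
    later terms, which differ from \<open>u N\<close> by less than 1.\<close>
  define B where "B = 1 + (\<Sum>n\<le>N. padic_abs p (u n))"
  have le: "padic_abs p (u n) \<le> B - 1" if "n \<le> N" for n
    using that unfolding B_def by (auto intro!: member_le_sum)
  have "padic_abs p (u n) \<le> B" for n
  proof (cases "n \<le> N")
    case False
    have "padic_abs p (u n) \<le> padic_abs p (u n - u N) + padic_abs p (u N)"
      using padic_abs_triangle[OF p, of "u n - u N" "u N"] by simp
    thus ?thesis using N[of n N] le[of N] False by simp
  qed (use le in force)
  moreover have "B > 0" unfolding B_def by (simp add: add_pos_nonneg sum_nonneg)
  ultimately show thesis using that by blast
qed

lemma padic_cauchy_const [simp]: "padic_cauchy p (\<lambda>_. x)"
  by (auto simp: padic_cauchy_def)

lemma padic_cauchy_uminus: "padic_cauchy p u \<Longrightarrow> padic_cauchy p (\<lambda>n. - u n)"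
  unfolding padic_cauchy_def minus_diff_minus padic_abs_minus .

lemma padic_cauchy_add:
  assumes p: "Factorial_Ring.prime p" and u: "padic_cauchy p u" and w: "padic_cauchy p w"
  shows "padic_cauchy p (\<lambda>n. u n + w n)"
  unfolding padic_cauchy_def
proof (intro allI impI)
  fix e :: real assume e: "e > 0"
  obtain N where N: "\<And>m n. m \<ge> N \<Longrightarrow> n \<ge> N \<Longrightarrow> padic_abs p (u m - u n) < e"
    using u e unfolding padic_cauchy_def by meson
  obtain N' where N': "\<And>m n. m \<ge> N' \<Longrightarrow> n \<ge> N' \<Longrightarrow> padic_abs p (w m - w n) < e"
    using w e unfolding padic_cauchy_def by meson
  have "padic_abs p (u m + w m - (u n + w n)) < e" if "m \<ge> max N N'" "n \<ge> max N N'" for m n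
    using padic_abs_ultrametric[OF p, of "u m - u n" "w m - w n"] N[of m n] N'[of m n] that
    by (auto simp: algebra_simps)
  thus "\<exists>N. \<forall>m\<ge>N. \<forall>n\<ge>N. padic_abs p (u m + w m - (u n + w n)) < e" by blast
qed

lemma padic_cauchy_mult:
  assumes p: "Factorial_Ring.prime p" and u: "padic_cauchy p u" and w: "padic_cauchy p w"
  shows "padic_cauchy p (\<lambda>n. u n * w n)"
  unfolding padic_cauchy_def
proof (intro allI impI)
  fix e :: real assume e: "e > 0"
  obtain B where B: "B > 0" "\<And>n. padic_abs p (u n) \<le> B" using padic_cauchy_bounded[OF p u] by blast
  obtain B' where B': "B' > 0" "\<And>n. padic_abs p (w n) \<le> B'" using padic_cauchy_bounded[OF p w] by blast
  have "e / B' > 0" "e / B > 0" using e B B' by auto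
  then obtain N N' where N: "\<And>m n. m \<ge> N \<Longrightarrow> n \<ge> N \<Longrightarrow> padic_abs p (u m - u n) < e / B'"
    and N': "\<And>m n. m \<ge> N' \<Longrightarrow> n \<ge> N' \<Longrightarrow> padic_abs p (w m - w n) < e / B"
    using u w unfolding padic_cauchy_def by meson
  have "padic_abs p (u m * w m - u n * w n) < e" if mn: "m \<ge> max N N'" "n \<ge> max N N'" for m n
  proof -
    have "padic_abs p (u m * (w m - w n)) \<le> B * padic_abs p (w m - w n)"
      unfolding padic_abs_mult[OF p] by (intro mult_right_mono B) simp
    also have "\<dots> < e" using N'[of m n] mn B by (simp add: field_simps)
    finally have 1: "padic_abs p (u m * (w m - w n)) < e" .
    have "padic_abs p ((u m - u n) * w n) \<le> padic_abs p (u m - u n) * B'"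
      unfolding padic_abs_mult[OF p] by (intro mult_left_mono B') simp
    also have "\<dots> < e" using N[of m n] mn B' by (simp add: field_simps)
    finally have 2: "padic_abs p ((u m - u n) * w n) < e" .
    have "u m * w m - u n * w n = u m * (w m - w n) + (u m - u n) * w n" by (simp add: algebra_simps)
    thus ?thesis using 1 2 padic_abs_ultrametric[OF p, of "u m * (w m - w n)" "(u m - u n) * w n"] by simp
  qed
  thus "\<exists>N. \<forall>m\<ge>N. \<forall>n\<ge>N. padic_abs p (u m * w m - u n * w n) < e" by blast
qed

lemma cring_padic_cauchy_ring:
  assumes p: "Factorial_Ring.prime p"
  shows "cring (padic_cauchy_ring p)"
proof (rule cringI)
  show "abelian_group (padic_cauchy_ring p)"
  proof (rule abelian_groupI)
    fix u assume "u \<in> carrier (padic_cauchy_ring p)"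
    thus "\<exists>y\<in>carrier (padic_cauchy_ring p). y \<oplus>\<^bsub>padic_cauchy_ring p\<^esub> u = \<zero>\<^bsub>padic_cauchy_ring p\<^esub>"
      by (intro bexI[of _ "\<lambda>n. - u n"]) (auto simp: padic_cauchy_ring_def padic_cauchy_uminus)
  qed (auto simp: padic_cauchy_ring_def padic_cauchy_add[OF p] algebra_simps)
  show "comm_monoid (padic_cauchy_ring p)"
    by (rule comm_monoidI) (auto simp: padic_cauchy_ring_def padic_cauchy_mult[OF p] algebra_simps)
qed (auto simp: padic_cauchy_ring_def algebra_simps)

lemma padic_cauchy_ring_uminus:
  assumes p: "Factorial_Ring.prime p" and "padic_cauchy p u"
  shows "\<ominus>\<^bsub>padic_cauchy_ring p\<^esub> u = (\<lambda>n. - u n)"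
proof -
  interpret cring "padic_cauchy_ring p" by (rule cring_padic_cauchy_ring[OF p])
  show ?thesis
    by (rule minus_equality) (use assms in \<open>auto simp: padic_cauchy_ring_def padic_cauchy_uminus\<close>)
qed

lemma padic_cauchy_ring_minus:
  assumes p: "Factorial_Ring.prime p" and "padic_cauchy p w"
  shows "u \<ominus>\<^bsub>padic_cauchy_ring p\<^esub> w = (\<lambda>n. u n - w n)"
  using assms by (simp add: a_minus_def padic_cauchy_ring_uminus) (simp add: padic_cauchy_ring_def)

lemma padic_null_imp_cauchy:
  assumes p: "Factorial_Ring.prime p" and u: "u \<in> padic_null p"
  shows "padic_cauchy p u"
  unfolding padic_cauchy_def
proof (intro allI impI)
  fix e :: real assume e: "e > 0"
  obtain N where N: "\<And>n. n \<ge> N \<Longrightarrow> padic_abs p (u n) < e"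
    using u e unfolding padic_null_def lim_sequentially by (auto simp: dist_real_def)
  have "padic_abs p (u m - u n) < e" if "m \<ge> N" "n \<ge> N" for m n
    using padic_abs_ultrametric[OF p, of "u m" "- u n"] N[OF that(1)] N[OF that(2)] by simp
  thus "\<exists>N. \<forall>m\<ge>N. \<forall>n\<ge>N. padic_abs p (u m - u n) < e" by blast
qed

lemma padic_null_add:
  assumes p: "Factorial_Ring.prime p" and u: "u \<in> padic_null p" and w: "w \<in> padic_null p"
  shows "(\<lambda>n. u n + w n) \<in> padic_null p"
proof -
  have "(\<lambda>n. padic_abs p (u n) + padic_abs p (w n)) \<longlonglongrightarrow> 0 + 0"
    using u w by (intro tendsto_add) (auto simp: padic_null_def)
  hence "(\<lambda>n. padic_abs p (u n) + padic_abs p (w n)) \<longlonglongrightarrow> 0" by simp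
  hence "(\<lambda>n. padic_abs p (u n + w n)) \<longlonglongrightarrow> 0"
    by (rule tendsto_sandwich[OF always_eventually always_eventually tendsto_const, rotated 2])
      (simp_all add: padic_abs_triangle[OF p])
  thus ?thesis by (simp add: padic_null_def)
qed

lemma padic_null_mult:
  assumes p: "Factorial_Ring.prime p" and u: "padic_cauchy p u" and w: "w \<in> padic_null p"
  shows "(\<lambda>n. u n * w n) \<in> padic_null p"
proof -
  obtain B where B: "B > 0" "\<And>n. padic_abs p (u n) \<le> B" using padic_cauchy_bounded[OF p u] by blast
  have "(\<lambda>n. B * padic_abs p (w n)) \<longlonglongrightarrow> B * 0"
    using w by (intro tendsto_mult) (auto simp: padic_null_def)
  hence "(\<lambda>n. B * padic_abs p (w n)) \<longlonglongrightarrow> 0" by simp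
  hence "(\<lambda>n. padic_abs p (u n * w n)) \<longlonglongrightarrow> 0"
    by (rule tendsto_sandwich[OF always_eventually always_eventually tendsto_const, rotated 2])
      (simp_all add: padic_abs_mult[OF p] B mult_right_mono)
  thus ?thesis by (simp add: padic_null_def)
qed

lemma ideal_padic_null:
  assumes p: "Factorial_Ring.prime p"
  shows "ideal (padic_null p) (padic_cauchy_ring p)"
proof (rule idealI)
  interpret cring "padic_cauchy_ring p" by (rule cring_padic_cauchy_ring[OF p])
  show "ring (padic_cauchy_ring p)" by (rule ring_axioms)
  show "subgroup (padic_null p) (add_monoid (padic_cauchy_ring p))"
  proof (rule add.subgroupI)
    show "padic_null p \<subseteq> carrier (padic_cauchy_ring p)"
      by (auto simp: padic_cauchy_ring_def padic_null_imp_cauchy[OF p])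
    have "(\<lambda>_. 0) \<in> padic_null p" by (simp add: padic_null_def)
    thus "padic_null p \<noteq> {}" by blast
    fix u assume u: "u \<in> padic_null p"
    thus "\<ominus>\<^bsub>padic_cauchy_ring p\<^esub> u \<in> padic_null p"
      by (simp add: padic_cauchy_ring_uminus[OF p] padic_null_imp_cauchy[OF p])
         (simp add: padic_null_def)
    fix w assume "w \<in> padic_null p"
    thus "u \<oplus>\<^bsub>padic_cauchy_ring p\<^esub> w \<in> padic_null p"
      using padic_null_add[OF p u] by (simp add: padic_cauchy_ring_def)
  qed
  fix u w assume u: "u \<in> padic_null p" and w: "w \<in> carrier (padic_cauchy_ring p)"
  show "w \<otimes>\<^bsub>padic_cauchy_ring p\<^esub> u \<in> padic_null p"
    using padic_null_mult[OF p _ u] w by (simp add: padic_cauchy_ring_def)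
  show "u \<otimes>\<^bsub>padic_cauchy_ring p\<^esub> w \<in> padic_null p"
    using padic_null_mult[OF p _ u, of w] w by (simp add: padic_cauchy_ring_def mult.commute)
qed

section \<open>Hensel's lemma and p-adic square roots\<close>

text \<open>Newton's correction: if \<open>x\<^sup>2 - D = p ^ Suc n * e\<close>, adding
  \<open>k * p ^ Suc n\<close> to \<open>x\<close> changes \<open>e\<close> to
  \<open>e + 2 * x * k\<close> modulo \<open>p\<close>, and \<open>2 * x\<close> is invertible
  modulo \<open>p\<close> since \<open>p\<close> is odd and does not divide
  \<open>D\<close>.\<close>

lemma hensel_sqrt:
  fixes p :: nat and D :: int
  assumes p: "Factorial_Ring.prime p" "p > 2" and D: "\<not> int p dvd D" "QuadRes p D"
  obtains s :: "nat \<Rightarrow> int" where "\<And>n. int p ^ Suc n dvd (s n)\<^sup>2 - D"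
    "\<And>n. int p ^ Suc n dvd s (Suc n) - s n"
proof -
  have "\<exists>s. \<forall>n. int p ^ Suc n dvd (s n)\<^sup>2 - D \<and> int p ^ Suc n dvd s (Suc n) - s n"
  \<comment> \<open>The exponents are shifted by one because the choice starts at index 0 from a
    root modulo \<open>p\<close>.\<close>
  proof (rule dependent_nat_choice)
    show "\<exists>x. int p ^ Suc 0 dvd x\<^sup>2 - D"
      using D(2) by (simp add: QuadRes_def cong_iff_dvd_diff)
  next
    fix x n assume x: "int p ^ Suc n dvd x\<^sup>2 - D"
    then obtain e where e: "x\<^sup>2 - D = int p ^ Suc n * e" by (auto elim: dvdE)
    have "\<not> int p dvd x"
    proof
      assume "int p dvd x"
      moreover have "int p dvd x\<^sup>2 - D" using x dvd_trans[of "int p" "int p ^ Suc n"] by simp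
      ultimately have "int p dvd D" by (metis dvd_diff_right_iff dvd_mult2 power2_eq_square dvd_diff_commute)
      thus False using D by simp
    qed
    moreover have "\<not> int p dvd 2" using p(2) by (auto dest: zdvd_imp_le)
    ultimately have "coprime (2 * x) (int p)" using p(1)
      by (metis coprime_commute prime_dvd_mult_iff prime_imp_coprime prime_nat_int_transfer)
    then obtain i where i: "[2 * x * i = 1] (mod int p)" using cong_solve_coprime_int by blast
    \<comment> \<open>This solves \<open>e + 2 * x * k = 0\<close> modulo \<open>p\<close>, as
      \<open>i\<close> inverts \<open>2 * x\<close>.\<close>
    define k where "k = - e * i"
    have "[e + 2 * x * k = e + - e * (2 * x * i)] (mod int p)" by (simp add: k_def algebra_simps)
    also have "[e + - e * (2 * x * i) = e + - e * 1] (mod int p)"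
      using i by (intro cong_add cong_mult cong_refl)
    finally have "int p dvd e + 2 * x * k" by (simp add: cong_0_iff)
    then obtain l where l: "e + 2 * x * k = int p * l" by (auto elim: dvdE)
    define y where "y = x + k * int p ^ Suc n"
    have "y\<^sup>2 - D = (x\<^sup>2 - D) + int p ^ Suc n * (2 * x * k) + int p ^ Suc n * int p ^ Suc n * k\<^sup>2"
      by (simp add: y_def power2_eq_square algebra_simps)
    also have "\<dots> = int p ^ Suc n * (e + 2 * x * k) + int p ^ Suc n * int p ^ Suc n * k\<^sup>2"
      by (simp add: e algebra_simps)
    also have "\<dots> = int p ^ Suc (Suc n) * (l + int p ^ n * k\<^sup>2)"
      unfolding l by (simp add: algebra_simps)
    finally have "int p ^ Suc (Suc n) dvd y\<^sup>2 - D" by simp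
    moreover have "int p ^ Suc n dvd y - x" by (simp add: y_def)
    ultimately show "\<exists>y. int p ^ Suc (Suc n) dvd y\<^sup>2 - D \<and> int p ^ Suc n dvd y - x" by blast
  qed
  thus thesis using that by blast
qed

text \<open>The approximations of \<open>hensel_sqrt\<close> form a Cauchy sequence, as consecutive
  ones agree modulo ever higher powers of \<open>p\<close>. The equation for the square is phrased
  by a null sequence, which becomes 0 in the quotient.\<close>

lemma padic_sqrt_exists:
  fixes p :: nat and D :: int
  assumes p: "Factorial_Ring.prime p" "p > 2" and D: "\<not> int p dvd D" "QuadRes p D"
  obtains s where "padic_cauchy p s" "(\<lambda>n. (s n)\<^sup>2 - of_int D) \<in> padic_null p"
proof -
  obtain s where s: "\<And>n. int p ^ Suc n dvd (s n)\<^sup>2 - D" "\<And>n. int p ^ Suc n dvd s (Suc n) - s n"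
    using hensel_sqrt[OF assms] by blast
  have p1: "0 \<le> 1 / real p" "1 / real p < 1" using p(2) by auto
  have dvd: "int p ^ N dvd s n - s N" if "n \<ge> N" for n N
    using that
  proof (induction n rule: dec_induct)
    case (step n)
    have "int p ^ N dvd s (Suc n) - s n"
      using s(2)[of n] step le_imp_power_dvd[of N "Suc n" "int p"] dvd_trans by fastforce
    thus ?case using step.IH dvd_add[of _ "s (Suc n) - s n" "s n - s N"] by simp
  qed auto
  have "padic_cauchy p (\<lambda>n. of_int (s n))"
    unfolding padic_cauchy_def
  proof (intro allI impI)
    fix e :: real assume "e > 0"
    then obtain N where N: "(1 / real p) ^ N < e" using real_arch_pow_inv p1 by blast
    have "padic_abs p (of_int (s m) - of_int (s n)) < e" if "m \<ge> N" "n \<ge> N" for m n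
    proof -
      have "int p ^ N dvd s m - s n"
        using dvd_diff[OF dvd[OF that(1)] dvd[OF that(2)]] by simp
      from padic_abs_of_int_le[OF p(1) this] show ?thesis using N by simp
    qed
    thus "\<exists>N. \<forall>m\<ge>N. \<forall>n\<ge>N. padic_abs p (of_int (s m) - of_int (s n)) < e" by blast
  qed
  moreover have "(\<lambda>n. (of_int (s n))\<^sup>2 - of_int D) \<in> padic_null p"
  proof -
    have le: "padic_abs p ((of_int (s n))\<^sup>2 - of_int D) \<le> (1 / real p) ^ Suc n" for n
      using padic_abs_of_int_le[OF p(1) s(1)[of n]] by simp
    have "(\<lambda>n. padic_abs p ((of_int (s n))\<^sup>2 - of_int D)) \<longlonglongrightarrow> 0"
    proof (rule tendsto_sandwich[OF always_eventually always_eventually tendsto_const])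
      show "(\<lambda>n. (1 / real p) ^ Suc n) \<longlonglongrightarrow> 0"
        using LIMSEQ_Suc[OF LIMSEQ_realpow_zero[OF p1]] .
    qed (use le in \<open>simp_all del: power_Suc\<close>)
    thus ?thesis by (simp add: padic_null_def)
  qed
  ultimately show thesis by (rule that)
qed

section \<open>Quaternion algebras\<close>

lemma division_ring_no_zero_divisors:
  assumes "is_division_ring D" "x \<in> carrier D" "y \<in> carrier D" "x \<otimes>\<^bsub>D\<^esub> y = \<zero>\<^bsub>D\<^esub>"
  shows "x = \<zero>\<^bsub>D\<^esub> \<or> y = \<zero>\<^bsub>D\<^esub>"
proof (rule disjCI)
  interpret ring D using assms(1) by (simp add: is_division_ring_def)
  assume "y \<noteq> \<zero>\<^bsub>D\<^esub>"
  hence "y \<in> Units D" using assms by (simp add: is_division_ring_def)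
  then obtain z where z: "z \<in> carrier D" "y \<otimes>\<^bsub>D\<^esub> z = \<one>\<^bsub>D\<^esub>" by (auto simp: Units_def)
  have "x = x \<otimes>\<^bsub>D\<^esub> (y \<otimes>\<^bsub>D\<^esub> z)" using z assms by simp
  also have "\<dots> = (x \<otimes>\<^bsub>D\<^esub> y) \<otimes>\<^bsub>D\<^esub> z" using z assms by (intro m_assoc[symmetric])
  finally show "x = \<zero>\<^bsub>D\<^esub>" using assms z by simp
qed

text \<open>Lets products of quaternions over \<open>padic_field\<close> be computed with Cauchy
  sequences before passing to cosets.\<close>

lemma (in ring_hom_ring) quat_mult_map_quat:
  assumes "a \<in> carrier R" "b \<in> carrier R" "set_quat x \<subseteq> carrier R" "set_quat y \<subseteq> carrier R"
  shows "quat_mult S (h a) (h b) (map_quat h x) (map_quat h y) = map_quat h (quat_mult R a b x y)"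
  using assms by (cases x; cases y) (simp add: quat_mult_def a_minus_def)

text \<open>For \<open>q = u i + v j + w ij\<close> one has \<open>q\<^sup>2 = D\<close>; if also
  \<open>s\<^sup>2 = D\<close> in the completion, then \<open>(q - s)(q + s) = 0\<close>. Neither
  factor, called \<open>P\<close> and \<open>Q\<close> below, is zero, because \<open>D\<close>
  being nonzero prevents \<open>u\<close>, \<open>v\<close>, \<open>w\<close> from all
  vanishing.\<close>

lemma not_division_ring_if_padic_sqrt:
  assumes p: "Factorial_Ring.prime p" and s: "padic_cauchy p s" "(\<lambda>n. (s n)\<^sup>2 - D) \<in> padic_null p"
    and D: "D = a * u\<^sup>2 + b * v\<^sup>2 - a * b * w\<^sup>2" "D \<noteq> 0"
  shows "\<not> is_division_ring (quat_alg (padic_field p) (padic_of_rat p a) (padic_of_rat p b))"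
proof
  let ?C = "padic_cauchy_ring p"
  define h where "h = (+>\<^bsub>?C\<^esub>) (padic_null p)"
  interpret I: ideal "padic_null p" ?C by (rule ideal_padic_null[OF p])
  interpret H: ring_hom_ring ?C "padic_field p" h
    unfolding h_def padic_field_def by (rule I.rcos_ring_hom_ring)
  define P where "P = Quat (\<lambda>n. - s n) (\<lambda>_. u) (\<lambda>_. v) (\<lambda>_. w)"
  define Q where "Q = Quat s (\<lambda>_. u) (\<lambda>_. v) (\<lambda>_. w)"
  assume div: "is_division_ring (quat_alg (padic_field p) (padic_of_rat p a) (padic_of_rat p b))"
  have zero: "\<zero>\<^bsub>padic_field p\<^esub> = padic_null p" by (simp add: padic_field_def FactRing_def)
  have h_zero: "h x = \<zero>\<^bsub>padic_field p\<^esub>" if "x \<in> padic_null p" for x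
    unfolding h_def zero using that by (rule I.a_rcos_const)
  \<comment> \<open>A constant sequence is null only if the constant is 0, so nonzero rational
    coordinates stay nonzero in the quotient.\<close>
  have h_const: "c = 0" if "h (\<lambda>_. c) = \<zero>\<^bsub>padic_field p\<^esub>" for c
  proof -
    have "(\<lambda>_. c) \<in> h (\<lambda>_. c)" unfolding h_def by (rule I.a_rcos_self) (simp add: padic_cauchy_ring_def)
    hence "(\<lambda>n :: nat. padic_abs p c) \<longlonglongrightarrow> 0" using that zero by (simp add: padic_null_def)
    hence "padic_abs p c = 0" using LIMSEQ_const_iff by blast
    thus ?thesis using padic_abs_pos[OF p, of c] by fastforce
  qed
  have PQ: "set_quat P \<subseteq> carrier ?C" "set_quat Q \<subseteq> carrier ?C"
    using s(1) by (auto simp: P_def Q_def padic_cauchy_ring_def padic_cauchy_uminus)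
  have cc: "(\<lambda>_. x) \<in> carrier ?C" for x by (simp add: padic_cauchy_ring_def)
  have "quat_mult ?C (\<lambda>_. a) (\<lambda>_. b) P Q = Quat (\<lambda>n. D - (s n)\<^sup>2) (\<lambda>_. 0) (\<lambda>_. 0) (\<lambda>_. 0)"
    unfolding quat_mult_def
    by (subst (1 2 3 4) padic_cauchy_ring_minus[OF p])
       (use s(1) in \<open>auto simp: P_def Q_def padic_cauchy_ring_def D padic_cauchy_mult[OF p]
          power2_eq_square algebra_simps\<close>)
  moreover have "(\<lambda>n. D - (s n)\<^sup>2) \<in> padic_null p"
    using s(2) by (simp add: padic_null_def padic_abs_diff_commute)
  moreover have "(\<lambda>_. 0) \<in> padic_null p" by (simp add: padic_null_def)
  ultimately have "quat_mult (padic_field p) (h (\<lambda>_. a)) (h (\<lambda>_. b)) (map_quat h P) (map_quat h Q)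
      = \<zero>\<^bsub>quat_alg (padic_field p) (padic_of_rat p a) (padic_of_rat p b)\<^esub>"
    using H.quat_mult_map_quat[OF cc cc PQ] by (simp add: h_zero quat_alg_def)
  moreover have "h (\<lambda>_. x) = padic_of_rat p x" for x by (simp add: h_def padic_of_rat_def)
  ultimately have "map_quat h P \<otimes>\<^bsub>quat_alg (padic_field p) (padic_of_rat p a) (padic_of_rat p b)\<^esub> map_quat h Q
      = \<zero>\<^bsub>quat_alg (padic_field p) (padic_of_rat p a) (padic_of_rat p b)\<^esub>"
    by (simp add: quat_alg_def)
  moreover have "map_quat h P \<in> carrier (quat_alg (padic_field p) (padic_of_rat p a) (padic_of_rat p b))"
      "map_quat h Q \<in> carrier (quat_alg (padic_field p) (padic_of_rat p a) (padic_of_rat p b))"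
    using PQ by (auto simp: quat_alg_def P_def Q_def)
  ultimately have "map_quat h P = Quat \<zero>\<^bsub>padic_field p\<^esub> \<zero>\<^bsub>padic_field p\<^esub> \<zero>\<^bsub>padic_field p\<^esub> \<zero>\<^bsub>padic_field p\<^esub>
     \<or> map_quat h Q = Quat \<zero>\<^bsub>padic_field p\<^esub> \<zero>\<^bsub>padic_field p\<^esub> \<zero>\<^bsub>padic_field p\<^esub> \<zero>\<^bsub>padic_field p\<^esub>"
    using division_ring_no_zero_divisors[OF div] by (simp add: quat_alg_def)
  hence "u = 0" "v = 0" "w = 0" using h_const by (auto simp: P_def Q_def)
  thus False using D by simp
qed

text \<open>Hensel's lemma turns a quadratic residue prime to \<open>p\<close> into a p-adic square,
  which would produce zero divisors at \<open>p\<close>.\<close>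

lemma ramified_at_finite_imp_not_QuadRes:
  assumes "ramified_at a b (Finite_Place p)" "p > 2" "\<not> int p dvd D"
    and "of_int D = a * u\<^sup>2 + b * v\<^sup>2 - a * b * w\<^sup>2"
  shows "\<not> QuadRes p D"
proof
  assume "QuadRes p D"
  moreover have p: "Factorial_Ring.prime p" using assms(1) by simp
  ultimately obtain s where "padic_cauchy p s" "(\<lambda>n. (s n)\<^sup>2 - of_int D) \<in> padic_null p"
    using padic_sqrt_exists assms by blast
  moreover have "of_int D \<noteq> (0 :: rat)" using assms(3) by auto
  ultimately show False using not_division_ring_if_padic_sqrt[OF p _ _ assms(4)] assms(1) by simp
qed

lemma quat_mult_type_algebra:
  fixes a b :: "'a :: comm_ring_1"
  shows "quat_mult ring_of_type_algebra a b (Quat x0 x1 x2 x3) (Quat y0 y1 y2 y3) =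
    Quat (x0 * y0 + a * (x1 * y1) + b * (x2 * y2) - a * b * (x3 * y3))
      (x0 * y1 + x1 * y0 + b * (x3 * y2 - x2 * y3))
      (x0 * y2 + x2 * y0 + a * (x1 * y3 - x3 * y1))
      (x0 * y3 + x3 * y0 + (x1 * y2 - x2 * y1))"
  by (simp add: quat_mult_def minus_ring_of_type_algebra) (simp add: ring_of_type_algebra_def)

text \<open>If \<open>a > 0\<close>, then \<open>sqrt a + i\<close> and \<open>sqrt a - i\<close>
  are zero divisors over the reals; for \<open>b\<close> the same works with
  \<open>j\<close>.\<close>

lemma ramified_at_infinite_imp_neg:
  assumes "ramified_at a b Infinite_Place" "a \<noteq> 0" "b \<noteq> 0"
  shows "a < 0" "b < 0"
proof -
  let ?A = "quat_alg (ring_of_type_algebra :: real ring) (of_rat a) (of_rat b)"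
  have no_zd: "x = \<zero>\<^bsub>?A\<^esub> \<or> y = \<zero>\<^bsub>?A\<^esub>" if "x \<otimes>\<^bsub>?A\<^esub> y = \<zero>\<^bsub>?A\<^esub>" for x y
    using assms(1) that
    by (intro division_ring_no_zero_divisors) (auto simp: quat_alg_def ring_of_type_algebra_def)
  show "a < 0"
  proof (rule ccontr)
    assume "\<not> a < 0"
    hence "a > 0" using assms by simp
    hence "sqrt (of_rat a) * sqrt (of_rat a) = of_rat a" by simp
    hence "Quat (sqrt (of_rat a)) 1 0 0 \<otimes>\<^bsub>?A\<^esub> Quat (sqrt (of_rat a)) (-1) 0 0 = \<zero>\<^bsub>?A\<^esub>"
      by (simp add: quat_alg_def quat_mult_type_algebra) (simp add: ring_of_type_algebra_def)
    from no_zd[OF this] show False by (simp add: quat_alg_def ring_of_type_algebra_def)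
  qed
  show "b < 0"
  proof (rule ccontr)
    assume "\<not> b < 0"
    hence "b > 0" using assms by simp
    hence "sqrt (of_rat b) * sqrt (of_rat b) = of_rat b" by simp
    hence "Quat (sqrt (of_rat b)) 0 1 0 \<otimes>\<^bsub>?A\<^esub> Quat (sqrt (of_rat b)) 0 (-1) 0 = \<zero>\<^bsub>?A\<^esub>"
      by (simp add: quat_alg_def quat_mult_type_algebra) (simp add: ring_of_type_algebra_def)
    from no_zd[OF this] show False by (simp add: quat_alg_def ring_of_type_algebra_def)
  qed
qed

section \<open>Minimal polynomials and integers of the algebra\<close>

lemma abelian_monoid_rat_quat_alg: "abelian_monoid (rat_quat_alg a b)"
  by (rule abelian_monoidI) (auto simp: quat_alg_def ring_of_type_algebra_def)

lemma carrier_rat_quat_alg [simp]: "carrier (rat_quat_alg a b) = UNIV"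
  by (simp add: quat_alg_def ring_of_type_algebra_def)

text \<open>Since every quaternion satisfies a monic quadratic, degree 2 suffices for minimal
  polynomials. The last three coordinates share a factor because the pure part of
  \<open>x\<^sup>2\<close> is \<open>2 * t\<close> times that of \<open>x\<close>.\<close>

lemma quat_poly_eval_upto_degree_2:
  assumes "Polynomial.degree f \<le> 2" "x = Quat t u v w"
  shows "quat_poly_eval a b f x =
    Quat (Polynomial.coeff f 0 + Polynomial.coeff f 1 * t
           + Polynomial.coeff f 2 * (t\<^sup>2 + a * u\<^sup>2 + b * v\<^sup>2 - a * b * w\<^sup>2))
      ((Polynomial.coeff f 1 + 2 * Polynomial.coeff f 2 * t) * u)
      ((Polynomial.coeff f 1 + 2 * Polynomial.coeff f 2 * t) * v)
      ((Polynomial.coeff f 1 + 2 * Polynomial.coeff f 2 * t) * w)"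
proof -
  interpret abelian_monoid "rat_quat_alg a b" by (rule abelian_monoid_rat_quat_alg)
  let ?A = "rat_quat_alg a b"
  let ?g = "\<lambda>i. quat_of_rat (Polynomial.coeff f i) \<otimes>\<^bsub>?A\<^esub> (x [^]\<^bsub>?A\<^esub> i)"
  have pow: "x [^]\<^bsub>?A\<^esub> (0 :: nat) = Quat 1 0 0 0" "x [^]\<^bsub>?A\<^esub> Suc i = quat_mult ring_of_type_algebra a b (x [^]\<^bsub>?A\<^esub> i) x" for i
    by (simp_all add: nat_pow_def quat_alg_def ring_of_type_algebra_def)
  have "quat_poly_eval a b f x = (\<Oplus>\<^bsub>?A\<^esub> i\<in>{..Polynomial.degree f}. ?g i)"
    by (simp add: quat_poly_eval_def)
  \<comment> \<open>Padding the sum with zero terms to a fixed range lets one computation serve all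
    degrees.\<close>
  also have "\<dots> = (\<Oplus>\<^bsub>?A\<^esub> i\<in>{..2}. ?g i)"
  proof (rule add.finprod_mono_neutral_cong_left)
    fix i assume "i \<in> {..2} - {..Polynomial.degree f}"
    hence "Polynomial.coeff f i = 0" by (simp add: coeff_eq_0)
    thus "?g i = \<zero>\<^bsub>?A\<^esub>"
      by (cases "x [^]\<^bsub>?A\<^esub> i")
         (simp add: quat_alg_def quat_of_rat_def quat_mult_type_algebra, simp add: ring_of_type_algebra_def)
  qed (use assms(1) in auto)
  also have "\<dots> = ?g 2 \<oplus>\<^bsub>?A\<^esub> (?g 1 \<oplus>\<^bsub>?A\<^esub> ?g 0)"
    by (simp add: numeral_2_eq_2)
  also have "\<dots> = Quat (Polynomial.coeff f 0 + Polynomial.coeff f 1 * t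
           + Polynomial.coeff f 2 * (t\<^sup>2 + a * u\<^sup>2 + b * v\<^sup>2 - a * b * w\<^sup>2))
      ((Polynomial.coeff f 1 + 2 * Polynomial.coeff f 2 * t) * u)
      ((Polynomial.coeff f 1 + 2 * Polynomial.coeff f 2 * t) * v)
      ((Polynomial.coeff f 1 + 2 * Polynomial.coeff f 2 * t) * w)"
    unfolding numeral_2_eq_2 One_nat_def pow assms(2) quat_of_rat_def
    by (simp add: quat_alg_def quat_mult_type_algebra)
       (simp add: ring_of_type_algebra_def power2_eq_square algebra_simps)
  finally show ?thesis .
qed

text \<open>For nonrational \<open>x\<close> the minimal polynomial is quadratic with linear
  coefficient \<open>- 2 * qre x\<close>; for rational \<open>x\<close> it is
  \<open>X - qre x\<close>, which gives the stronger second claim.\<close>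

lemma quat_integer_imp_Ints:
  assumes "quat_integer a b x"
  shows "2 * qre x \<in> \<int>" "qi x = 0 \<and> qj x = 0 \<and> qk x = 0 \<Longrightarrow> qre x \<in> \<int>"
proof -
  obtain f where f: "is_minimal_poly a b x f" "\<And>i. Polynomial.coeff f i \<in> \<int>"
    using assms by (auto simp: quat_integer_def)
  obtain t u v w where x: "x = Quat t u v w" by (cases x)
  have zero: "\<zero>\<^bsub>rat_quat_alg a b\<^esub> = Quat 0 0 0 0" by (simp add: quat_alg_def ring_of_type_algebra_def)
  define N where "N = reduced_norm a b x"
  \<comment> \<open>The reduced characteristic polynomial of \<open>x\<close>, which bounds the
    degree of \<open>f\<close>.\<close>
  define g where "g = [:N, - 2 * t, 1:]"
  have "quat_poly_eval a b g x = Quat 0 0 0 0"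
    by (subst quat_poly_eval_upto_degree_2[OF _ x])
       (auto simp: g_def N_def x reduced_norm_def numeral_2_eq_2 power2_eq_square algebra_simps)
  moreover have "g \<noteq> 0" "Polynomial.degree g = 2" by (auto simp: g_def)
  ultimately have deg: "Polynomial.degree f \<le> 2" using f(1) zero by (metis is_minimal_poly_def)
  have "quat_poly_eval a b f x = Quat 0 0 0 0" and lc: "lead_coeff f = 1"
    using f(1) zero by (auto simp: is_minimal_poly_def)
  hence ev: "Polynomial.coeff f 0 + Polynomial.coeff f 1 * t
           + Polynomial.coeff f 2 * (t\<^sup>2 + a * u\<^sup>2 + b * v\<^sup>2 - a * b * w\<^sup>2) = 0"
      "(Polynomial.coeff f 1 + 2 * Polynomial.coeff f 2 * t) * u = 0"
      "(Polynomial.coeff f 1 + 2 * Polynomial.coeff f 2 * t) * v = 0"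
      "(Polynomial.coeff f 1 + 2 * Polynomial.coeff f 2 * t) * w = 0"
    using quat_poly_eval_upto_degree_2[OF deg x] by auto
  have "2 * qre x \<in> \<int> \<and> (qi x = 0 \<and> qj x = 0 \<and> qk x = 0 \<longrightarrow> qre x \<in> \<int>)"
  proof -
    consider "Polynomial.degree f = 0" | "Polynomial.degree f = 1" | "Polynomial.degree f = 2"
      using deg by linarith
    thus ?thesis
    proof cases
      case 1
      \<comment> \<open>A constant monic polynomial is 1 and does not vanish at
        \<open>x\<close>.\<close>
      thus ?thesis using ev lc coeff_eq_0[of f 1] coeff_eq_0[of f 2] by simp
    next
      case 2
      hence "t = - Polynomial.coeff f 0" using ev(1) lc coeff_eq_0[of f 2] by simp
      hence "t \<in> \<int>" using f(2) by simp
      thus ?thesis by (simp add: x)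
    next
      case 3
      \<comment> \<open>A rational \<open>x\<close> would be a root of \<open>X - t\<close>, against
        the minimality of degree 2.\<close>
      have "\<not> (u = 0 \<and> v = 0 \<and> w = 0)"
      proof
        assume 0: "u = 0 \<and> v = 0 \<and> w = 0"
        have "quat_poly_eval a b [:- t, 1:] x = Quat 0 0 0 0"
          by (subst quat_poly_eval_upto_degree_2[OF _ x]) (auto simp: 0 numeral_2_eq_2)
        moreover have "[:- t, 1:] \<noteq> 0" "Polynomial.degree [:- t, 1:] = 1" by auto
        ultimately have "Polynomial.degree f \<le> 1" using f(1) zero by (metis is_minimal_poly_def)
        thus False using 3 by simp
      qed
      moreover from this have "Polynomial.coeff f 1 + 2 * Polynomial.coeff f 2 * t = 0"
        using ev by auto
      hence "2 * t = - Polynomial.coeff f 1" using 3 lc by simp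
      hence "2 * t \<in> \<int>" using f(2) by simp
      ultimately show ?thesis by (auto simp: x)
    qed
  qed
  thus "2 * qre x \<in> \<int>" "qi x = 0 \<and> qj x = 0 \<and> qk x = 0 \<Longrightarrow> qre x \<in> \<int>" by auto
qed

section \<open>Outliers from ramification\<close>

lemma outlier_if_small_QuadRes:
  fixes m r n :: nat
  assumes m: "m > 0" "\<nexists>k. m = k\<^sup>2"
    and r: "Factorial_Ring.prime r" "2 < r"
    and QR: "\<And>D :: int. D \<noteq> 0 \<Longrightarrow> \<bar>D\<bar> \<le> 4 * int m \<Longrightarrow> \<not> int r dvd D \<and> QuadRes r D"
    and ab: "a < 0" "b < 0" and ram: "ramified_at a b (Finite_Place r)"
  shows "outlier a b (m * r ^ (2 * n))"
  unfolding outlier_def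
proof (intro conjI notI)
  have r0: "r > 0" using r(2) by simp
  thus "m * r ^ (2 * n) > 0" using m by simp
  assume "\<exists>x. x \<in> carrier (rat_quat_alg a b) \<and> quat_integer a b x \<and>
            reduced_norm a b x = of_nat (m * r ^ (2 * n))"
  then obtain x where int: "quat_integer a b x" and norm: "reduced_norm a b x = of_nat (m * r ^ (2 * n))"
    by blast
  \<comment> \<open>\<open>e\<close> is the square of the pure part of \<open>x\<close>, so
    \<open>4 * e\<close> is the discriminant of its reduced characteristic polynomial.\<close>
  define e where "e = a * (qi x)\<^sup>2 + b * (qj x)\<^sup>2 - a * b * (qk x)\<^sup>2"
  obtain t where t: "2 * qre x = of_int t" using quat_integer_imp_Ints(1)[OF int] by (auto elim: Ints_cases)
  have "(qre x)\<^sup>2 - e = of_nat (m * r ^ (2 * n))"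
    using norm by (simp add: reduced_norm_def e_def)
  moreover have "(of_int t)\<^sup>2 = 4 * (qre x)\<^sup>2" by (simp flip: t add: power_mult_distrib)
  ultimately have e: "4 * e = (of_int t)\<^sup>2 - 4 * of_nat m * of_nat r ^ (2 * n)" by simp
  \<comment> \<open>A rational integer whose square is \<open>m * r ^ (2 * n)\<close> would make
    \<open>m\<close> a perfect square.\<close>
  have "\<not> (qi x = 0 \<and> qj x = 0 \<and> qk x = 0)"
  proof
    assume 0: "qi x = 0 \<and> qj x = 0 \<and> qk x = 0"
    then obtain z where z: "qre x = of_int z" using quat_integer_imp_Ints(2)[OF int] by (auto elim: Ints_cases)
    have "of_int (z\<^sup>2) = (of_int (int m * int r ^ (2 * n)) :: rat)"
      using norm 0 z by (simp add: reduced_norm_def)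
    hence z2: "z\<^sup>2 = int m * (int r ^ n)\<^sup>2" by (simp only: of_int_eq_iff power_even_eq)
    hence "(int r ^ n)\<^sup>2 dvd z\<^sup>2" by simp
    hence "int r ^ n dvd z" by simp
    then obtain y where "z = int r ^ n * y" by (auto elim: dvdE)
    hence "y\<^sup>2 = int m" using z2 r0 by (simp add: power_mult_distrib)
    hence "int m = int ((nat \<bar>y\<bar>)\<^sup>2)" by simp
    hence "m = (nat \<bar>y\<bar>)\<^sup>2" by (simp only: of_nat_eq_iff)
    thus False using m by blast
  qed
  \<comment> \<open>Definiteness: each signed term of \<open>e\<close> is nonpositive and vanishes
    only with its coordinate.\<close>
  moreover have "a * (qi x)\<^sup>2 \<le> 0" "b * (qj x)\<^sup>2 \<le> 0" "a * b * (qk x)\<^sup>2 \<ge> 0"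
    using ab by (auto simp: mult_le_0_iff zero_le_mult_iff)
  moreover have "a * (qi x)\<^sup>2 = 0 \<longleftrightarrow> qi x = 0" "b * (qj x)\<^sup>2 = 0 \<longleftrightarrow> qj x = 0"
      "a * b * (qk x)\<^sup>2 = 0 \<longleftrightarrow> qk x = 0"
    using ab by auto
  ultimately have e_neg: "e < 0" unfolding e_def by linarith
  \<comment> \<open>\<open>k\<close> is the largest exponent up to \<open>n\<close> with
    \<open>r ^ k\<close> dividing \<open>t\<close>; for \<open>k = n\<close>, which includes
    \<open>t = 0\<close>, the cofactor \<open>t'\<close> may be divisible by
    \<open>r\<close>.\<close>
  have "\<exists>k t'. k \<le> n \<and> t = int r ^ k * t' \<and> (k = n \<or> \<not> int r dvd t')"
  proof (cases "int r ^ n dvd t")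
    case True
    thus ?thesis unfolding dvd_def by blast
  next
    case False
    hence "t \<noteq> 0" by auto
    moreover have "\<not> is_unit (int r)" using r by auto
    ultimately obtain t' where "t = int r ^ multiplicity (int r) t * t'" "\<not> int r dvd t'"
      using multiplicity_decompose' by metis
    moreover have "multiplicity (int r) t < n" using False multiplicity_dvd' not_less by blast
    ultimately show ?thesis by (meson less_imp_le)
  qed
  then obtain k t' where k: "k \<le> n" and t': "t = int r ^ k * t'" and kt: "k = n \<or> \<not> int r dvd t'"
    by blast
  \<comment> \<open>The discriminant divided by \<open>r ^ (2 * k)\<close>.\<close>
  define D where "D = t'\<^sup>2 - 4 * int m * int r ^ (2 * (n - k))"
  have "2 * n = k * 2 + 2 * (n - k)" using k by simp
  hence pow: "int r ^ (2 * n) = (int r ^ k)\<^sup>2 * int r ^ (2 * (n - k))"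
    by (metis power_add power_mult)
  have "(int r ^ k)\<^sup>2 * D = t\<^sup>2 - 4 * int m * int r ^ (2 * n)"
    unfolding pow by (simp add: D_def t' power_mult_distrib algebra_simps)
  hence "(of_int ((int r ^ k)\<^sup>2 * D) :: rat) = of_int (t\<^sup>2 - 4 * int m * int r ^ (2 * n))"
    by simp
  also have "\<dots> = 4 * e" using e by simp
  finally have D: "(of_nat r ^ k)\<^sup>2 * of_int D = 4 * e" by simp
  have Dn: "D < 0"
  proof -
    have "(of_nat r ^ k)\<^sup>2 * (of_int D :: rat) < 0" using D e_neg by simp
    thus ?thesis by (auto simp: mult_less_0_iff)
  qed
  \<comment> \<open>\<open>D\<close> is the square of the pure part of \<open>x\<close> scaled by
    \<open>2 / r ^ k\<close>, the shape required by
    \<open>ramified_at_finite_imp_not_QuadRes\<close>.\<close>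
  have "of_int D = 4 * e / (of_nat r ^ k)\<^sup>2" using D r0 by (simp add: field_simps)
  hence De: "of_int D = a * (2 * qi x / of_nat r ^ k)\<^sup>2 + b * (2 * qj x / of_nat r ^ k)\<^sup>2
                    - a * b * (2 * qk x / of_nat r ^ k)\<^sup>2"
    by (simp add: e_def power_divide power_mult_distrib diff_divide_distrib add_divide_distrib algebra_simps)
  have "\<not> int r dvd D \<and> QuadRes r D"
  proof (cases "k = n")
    case True
    \<comment> \<open>As \<open>t'\<^sup>2\<close> is nonnegative and \<open>D\<close> negative,
      \<open>D\<close> lies between \<open>- 4 * m\<close> and 0, within the range of
      \<open>QR\<close>.\<close>
    hence "D = t'\<^sup>2 - 4 * int m" by (simp add: D_def)
    hence "\<bar>D\<bar> \<le> 4 * int m" using Dn by simp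
    thus ?thesis using QR Dn by simp
  next
    case False
    hence rt: "\<not> int r dvd t'" using kt by simp
    \<comment> \<open>A positive power of \<open>r\<close> survives in the second term of
      \<open>D\<close>, so \<open>D\<close> is congruent to the nonzero square
      \<open>t'\<^sup>2\<close> modulo \<open>r\<close>.\<close>
    have "int r dvd int r ^ (2 * (n - k))" using False k by (intro dvd_power) auto
    hence dvd: "int r dvd t'\<^sup>2 - D" by (simp add: D_def)
    hence "QuadRes r D" unfolding QuadRes_def cong_iff_dvd_diff by blast
    moreover have "\<not> int r dvd D"
    proof
      assume "int r dvd D"
      hence "int r dvd t'\<^sup>2" using dvd by (metis dvd_add diff_add_cancel)
      thus False using rt r(1) prime_dvd_power[of "int r" t' 2] by simp
    qed
    ultimately show ?thesis by simp
  qed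
  thus False using ramified_at_finite_imp_not_QuadRes[OF ram r(2) _ De] by blast
qed

theorem theorem5p16:
  fixes m :: nat
  assumes "m > 0" and "\<nexists>k. m = k\<^sup>2"
  shows "infinite {r :: nat. Factorial_Ring.prime r \<and>
    (\<forall>a b. a \<noteq> 0 \<longrightarrow> b \<noteq> 0 \<longrightarrow>
       {v. ramified_at a b v} = {Finite_Place r, Infinite_Place} \<longrightarrow>
       (\<forall>n\<ge>1. outlier a b (m * r ^ (2 * n))))}"
proof -
  let ?P = "{p :: nat. Factorial_Ring.prime p \<and> 2 < p \<and>
    (\<forall>D :: int. D \<noteq> 0 \<longrightarrow> \<bar>D\<bar> \<le> int (4 * m) \<longrightarrow> \<not> int p dvd D \<and> QuadRes p D)}"
  have "outlier a b (m * r ^ (2 * n))"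
    if "r \<in> ?P" "a \<noteq> 0" "b \<noteq> 0" "{v. ramified_at a b v} = {Finite_Place r, Infinite_Place}"
    for r n a b
  proof -
    \<comment> \<open>Ramification at \<open>r\<close> excludes discriminants that are squares
      there; ramification at infinity makes \<open>a\<close> and \<open>b\<close> negative.\<close>
    have "ramified_at a b (Finite_Place r)" "ramified_at a b Infinite_Place" using that(4) by blast+
    thus ?thesis
      using that assms ramified_at_infinite_imp_neg[OF _ that(2,3)]
      by (intro outlier_if_small_QuadRes) auto
  qed
  hence "?P \<subseteq> {r :: nat. Factorial_Ring.prime r \<and>
    (\<forall>a b. a \<noteq> 0 \<longrightarrow> b \<noteq> 0 \<longrightarrow>
       {v. ramified_at a b v} = {Finite_Place r, Infinite_Place} \<longrightarrow>
       (\<forall>n\<ge>1. outlier a b (m * r ^ (2 * n))))}"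
    by blast
  thus ?thesis using infinite_primes_all_small_QuadRes infinite_super by blast
qed

end
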